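(* Let the prior be the uniform distribution on $\mathcal{H}$ and let $H'\in\{1,\dots,H\}$. Among all posteriors with support a subset of $\mathcal{H}$ of size exactly $H'$, the best posterior $Q^{\ast}_{\mathrm{sq},\chi^2}(H')$ (i.e. the one minimizing $B_{\mathrm{sq},\chi^2}$) has its support on the ordered subset consisting of the smallest $H'$ values $\hat l_1\le\dots\le\hat l_{H'}$. Its weights $q^{\ast}_{i,\mathrm{sq},\chi^2}(H')$ are determined as the solution to the following fixed point equation in $\{q_i(H')\}_{i=1}^{H'}$: $$q_i(H')=\begin{cases}\dfrac1{H'}+\dfrac{2\left(\sum_{k=1}^{H'}(q_k(H'))^2\right)^{3/4}}{\sqrt[4]{\frac{(12m-11)H}{16m^3\delta}}}\left(\dfrac{\sum_{k=1}^{H'}\hat l_k}{H'}-\hat l_i\right) & i=1,\dots,H',\\[2mm] 0 & i=H'+1,\dots,H,\end{cases}$$ under the feasibility condition that $q_i(H')>0$ for $i=1,\dots,H'$.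
   Context: $\mathcal{H}=\{h_1,\dots,h_H\}$ is a finite set of classifiers with empirical risks in $[0,1]$ indexed so that $\hat l_1\le\dots\le\hat l_H$; $m\ge1$ is an integer (sample size); $\delta\in(0,1)$. A posterior is $Q=(q_1,\dots,q_H)$ with $q_i\ge0$, $\sum_iq_i=1$; its support is $\{h_i:q_i>0\}$. For the uniform prior, $B_{\mathrm{sq},\chi^2}(Q)=\sum_{i=1}^H\hat l_iq_i+\sqrt[4]{H\left(\sum_{i=1}^Hq_i^2\right)\frac{12m-11}{16m^3\delta}}$.
   Formalization: A best posterior with support of size exactly H' is assumed to exist (the minimum need not be attained, even if a feasible solution exists); it is shown to solve the equation, not conversely; with tied risks, support and uniqueness hold up to permuting classifiers of equal risk. *)

theory Defs
  imports Complex_Main "HOL-Combinatorics.Permutations"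
begin

(* A classifier is identified with its index in {1..H}; l i is its empirical risk.
   Posteriors are set to 0 outside {1..H}, so that equality of posteriors is
   equality of functions. *)

definition posteriors :: "nat \<Rightarrow> (nat \<Rightarrow> real) set" where
  "posteriors H = {q. (\<forall>i. 0 \<le> q i) \<and> (\<forall>i. i \<notin> {1..H} \<longrightarrow> q i = 0) \<and> (\<Sum>i=1..H. q i) = 1}"

definition supp :: "(nat \<Rightarrow> real) \<Rightarrow> nat set" where
  "supp q = {i. q i > 0}"

definition B_sq_chi2 :: "nat \<Rightarrow> (nat \<Rightarrow> real) \<Rightarrow> nat \<Rightarrow> real \<Rightarrow> (nat \<Rightarrow> real) \<Rightarrow> real" where
  "B_sq_chi2 H l m \<delta> q =
     (\<Sum>i=1..H. l i * q i) +
     root 4 (real H * (\<Sum>i=1..H. (q i)\<^sup>2) * ((12 * real m - 11) / (16 * real m ^ 3 * \<delta>)))"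

(* The minimum need not be attained (the competitors have support of size exactly H'),
   and with tied risks it can be attained by several posteriors. *)

definition best_posterior ::
    "nat \<Rightarrow> (nat \<Rightarrow> real) \<Rightarrow> nat \<Rightarrow> real \<Rightarrow> nat \<Rightarrow> (nat \<Rightarrow> real) \<Rightarrow> bool" where
  "best_posterior H l m \<delta> H' q \<longleftrightarrow>
     is_arg_min (B_sq_chi2 H l m \<delta>) (\<lambda>p. p \<in> posteriors H \<and> card (supp p) = H') q"

definition fixed_point_eq ::
    "nat \<Rightarrow> (nat \<Rightarrow> real) \<Rightarrow> nat \<Rightarrow> real \<Rightarrow> nat \<Rightarrow> (nat \<Rightarrow> real) \<Rightarrow> bool" where
  "fixed_point_eq H l m \<delta> H' q \<longleftrightarrow>
     (\<forall>i\<in>{1..H'}. q i =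
        1 / real H' +
        2 * (\<Sum>k=1..H'. (q k)\<^sup>2) powr (3/4) /
          root 4 ((12 * real m - 11) * real H / (16 * real m ^ 3 * \<delta>)) *
        ((\<Sum>k=1..H'. l k) / real H' - l i)) \<and>
     (\<forall>i\<in>{H'+1..H}. q i = 0)"

end

theory Submission
  imports Defs
begin

text \<open>
  Up to a positive factor \<open>c\<close>, the second summand of the bound is \<open>(\<Sum>q\<^sub>i\<^sup>2)\<^bsup>1/4\<^esup>\<close>, the square root
  of the Euclidean norm. The bound need not be convex, and a stationary point need not be a
  minimizer. Three observations replace convexity.

  Support: exchanging two weights leaves \<open>\<Sum>q\<^sub>i\<^sup>2\<close> alone and changes only the linear part. Hence a
  minimizer never charges a classifier while a strictly better one stays uncharged, and the charged
  classifiers beyond \<open>H'\<close> can be exchanged, at equal risk, for the uncharged ones among the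
  first \<open>H'\<close> (\<open>best_posterior_permute_support\<close>).

  Stationarity: all weights on the support are positive, so a minimizer can be moved both ways along
  every direction \<open>d\<close> of total mass \<open>0\<close> that lives on the support, and the derivative vanishes:
  \<open>c (\<Sum>q\<^sub>id\<^sub>i) + 2 (\<Sum>l\<^sub>id\<^sub>i) r\<^sup>3 = 0\<close> with \<open>r = (\<Sum>q\<^sub>i\<^sup>2)\<^bsup>1/4\<^esup>\<close> (\<open>best_posterior_stationary\<close>).
  For \<open>d = e\<^sub>i - e\<^sub>j\<close> this compares two weights, and summing over \<open>j\<close> gives the fixed point equation
  (\<open>best_posterior_fixed_point\<close>).

  Uniqueness: the fixed point equation can have two solutions, but the values of the bound at two
  distinct ones differ. If \<open>p\<close> and \<open>q\<close> are minimizers with the same support and fourth roots \<open>y\<close> and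
  \<open>x\<close>, stationarity of both along \<open>p - q\<close> together with the equality of their bounds forces
  \<open>(x - y)\<^sup>3 (x + y) = 0\<close>, and then \<open>p = q\<close> (\<open>best_posterior_unique_on_support\<close>). Any other
  minimizer is first moved onto the support \<open>{1..H'}\<close> by a permutation that preserves the risks.
\<close>

definition concentration_coeff :: "nat \<Rightarrow> nat \<Rightarrow> real \<Rightarrow> real" where
  "concentration_coeff H m \<delta> = root 4 ((12 * real m - 11) * real H / (16 * real m ^ 3 * \<delta>))"

lemma concentration_coeff_pos:
  assumes "m \<ge> 1" "0 < \<delta>" "H \<ge> 1"
  shows "0 < concentration_coeff H m \<delta>"
proof -
  have "real m \<ge> 1" "real H \<ge> 1" using assms by auto
  then show ?thesis
    using assms unfolding concentration_coeff_def
    by (intro real_root_gt_zero divide_pos_pos mult_pos_pos) auto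
qed

lemma B_sq_chi2_eq:
  "B_sq_chi2 H l m \<delta> q =
     (\<Sum>i=1..H. l i * q i) + concentration_coeff H m \<delta> * root 4 (\<Sum>i=1..H. (q i)\<^sup>2)"
  unfolding B_sq_chi2_def concentration_coeff_def
  by (simp add: real_root_mult[symmetric] mult_ac)

lemma root_4_cubed:
  fixes x :: real
  assumes "0 \<le> x"
  shows "root 4 x ^ 3 = x powr (3/4)"
proof (cases "x = 0")
  case False
  then have "x powr (3/4) = (x powr (1/4)) powr (real 3)"
    by (subst powr_powr) simp
  also have "\<dots> = (x powr (1/4)) ^ 3"
    using assms False by (subst powr_realpow) auto
  finally show ?thesis using assms by (simp add: root_powr_inverse)
qed simp

lemma supp_subset: "q \<in> posteriors H \<Longrightarrow> supp q \<subseteq> {1..H}"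
  by (force simp: posteriors_def supp_def)

lemma posterior_sum_squares_pos:
  assumes "q \<in> posteriors H"
  shows "0 < (\<Sum>i=1..H. (q i)\<^sup>2)"
proof -
  have "(\<Sum>i=1..H. (q i)\<^sup>2) \<noteq> 0"
  proof
    assume "(\<Sum>i=1..H. (q i)\<^sup>2) = 0"
    then have "\<forall>i\<in>{1..H}. q i = 0" by (simp add: sum_nonneg_eq_0_iff)
    then show False using assms by (simp add: posteriors_def)
  qed
  then show ?thesis by (simp add: less_le sum_nonneg)
qed

lemma best_posteriorD:
  assumes "best_posterior H l m \<delta> H' q"
  shows "q \<in> posteriors H" "card (supp q) = H'"
    and "\<And>p. \<lbrakk>p \<in> posteriors H; card (supp p) = H'\<rbrakk> \<Longrightarrow> B_sq_chi2 H l m \<delta> q \<le> B_sq_chi2 H l m \<delta> p"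
  using assms unfolding best_posterior_def is_arg_min_def by (auto simp: not_less)

lemma best_posterior_transfer:
  assumes "best_posterior H l m \<delta> H' q" "p \<in> posteriors H" "card (supp p) = H'"
    and "B_sq_chi2 H l m \<delta> p \<le> B_sq_chi2 H l m \<delta> q"
  shows "best_posterior H l m \<delta> H' p"
  using best_posteriorD[OF assms(1)] assms(2-4)
  unfolding best_posterior_def is_arg_min_def by (meson not_less order_trans)

section \<open>Location of the support\<close>

lemma posteriors_permute:
  assumes "q \<in> posteriors H" "\<sigma> permutes {1..H}"
  shows "q \<circ> \<sigma> \<in> posteriors H"
  using assms sum.permute[OF assms(2), of q] permutes_not_in[OF assms(2)]
  by (auto simp: posteriors_def)

lemma supp_permute:
  assumes "\<sigma> permutes A"
  shows "\<sigma> ` supp (q \<circ> \<sigma>) = supp q"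
proof
  show "supp q \<subseteq> \<sigma> ` supp (q \<circ> \<sigma>)"
  proof
    fix i assume "i \<in> supp q"
    moreover obtain k where "i = \<sigma> k" using permutes_surj[OF assms] by (rule surjE)
    ultimately show "i \<in> \<sigma> ` supp (q \<circ> \<sigma>)" by (auto simp: supp_def)
  qed
qed (auto simp: supp_def)

lemma card_supp_permute:
  assumes "\<sigma> permutes A"
  shows "card (supp (q \<circ> \<sigma>)) = card (supp q)"
  using card_image[OF inj_on_subset[OF permutes_inj[OF assms] subset_UNIV], of "supp (q \<circ> \<sigma>)"]
    supp_permute[OF assms] by metis

lemma B_sq_chi2_transpose:
  assumes "i \<in> {1..H}" "j \<in> {1..H}"
  shows "B_sq_chi2 H l m \<delta> (q \<circ> transpose i j) = B_sq_chi2 H l m \<delta> q + (l i - l j) * (q j - q i)"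
proof (cases "i = j")
  case False
  let ?\<tau> = "transpose i j"
  have \<tau>: "?\<tau> permutes {1..H}" using assms by (rule permutes_swap_id)
  have "(\<Sum>k=1..H. l k * q (?\<tau> k)) - (\<Sum>k=1..H. l k * q k)
      = (\<Sum>k=1..H. l k * (q (?\<tau> k) - q k))"
    by (simp add: sum_subtractf right_diff_distrib)
  also have "\<dots> = (\<Sum>k\<in>{i,j}. l k * (q (?\<tau> k) - q k))"
    using assms by (intro sum.mono_neutral_right) (auto simp: transpose_def)
  also have "\<dots> = (l i - l j) * (q j - q i)"
    using False by (simp add: algebra_simps)
  finally show ?thesis
    using sum.permute[OF \<tau>, of "\<lambda>k. (q k)\<^sup>2"] by (simp add: B_sq_chi2_eq o_def)
qed simp

text \<open>
  Induction on the number of charged classifiers beyond \<open>H'\<close>. Exchanging one of them, \<open>i\<close>, for an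
  uncharged \<open>j \<le> H'\<close> changes the bound by \<open>(l j - l i) q\<^sub>i\<close>: minimality gives \<open>l i \<le> l j\<close>, the
  ordering gives \<open>l j \<le> l i\<close>, so the exchange is between equal risks and keeps minimality.
\<close>

lemma best_posterior_permute_support:
  assumes "best_posterior H l m \<delta> H' p" and sorted: "mono_on {1..H} l" and "H' \<le> H"
  shows "\<exists>\<sigma>. \<sigma> permutes {1..H} \<and> (\<forall>i\<in>{1..H}. l (\<sigma> i) = l i) \<and>
           best_posterior H l m \<delta> H' (p \<circ> \<sigma>) \<and> supp (p \<circ> \<sigma>) = {1..H'}"
  using assms(1)
proof (induction "card (supp p - {1..H'})" arbitrary: p rule: less_induct)
  case less
  note best = best_posteriorD[OF less.prems]
  have sub: "supp p \<subseteq> {1..H}" by (rule supp_subset[OF best(1)])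
  have fin: "finite (supp p)" using sub finite_subset by blast
  show ?case
  proof (cases "supp p = {1..H'}")
    case True
    then show ?thesis using less.prems by (intro exI[of _ id]) (simp add: permutes_id)
  next
    case False
    have "\<not> supp p \<subseteq> {1..H'}"
      using False best(2) card_subset_eq[of "{1..H'}" "supp p"] by auto
    then obtain i where i: "i \<in> supp p" "i \<notin> {1..H'}" by blast
    have "\<not> {1..H'} \<subseteq> supp p"
      using False best(2) card_subset_eq[OF fin, of "{1..H'}"] by auto
    then obtain j where j: "j \<in> {1..H'}" "j \<notin> supp p" by blast
    let ?\<tau> = "transpose i j"
    have ij: "i \<in> {1..H}" "j \<in> {1..H}" using i j sub \<open>H' \<le> H\<close> by auto
    have \<tau>: "?\<tau> permutes {1..H}" using ij by (rule permutes_swap_id)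
    have pij: "p i > 0" "p j = 0"
      using i j best(1) by (auto simp: supp_def posteriors_def not_less intro: antisym)
    have feas: "p \<circ> ?\<tau> \<in> posteriors H" "card (supp (p \<circ> ?\<tau>)) = H'"
      using posteriors_permute[OF best(1) \<tau>] card_supp_permute[OF \<tau>] best(2) by auto
    have diff: "B_sq_chi2 H l m \<delta> (p \<circ> ?\<tau>) = B_sq_chi2 H l m \<delta> p - (l i - l j) * p i"
      using B_sq_chi2_transpose[OF ij, of l m \<delta> p] pij by (simp add: algebra_simps)
    have "(l i - l j) * p i \<le> 0" using best(3)[OF feas] diff by simp
    then have "l i \<le> l j" using pij by (simp add: mult_le_0_iff)
    moreover have "l j \<le> l i"
      using i j ij by (intro mono_onD[OF sorted]) auto
    ultimately have lij: "l i = l j" by simp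
    have best\<tau>: "best_posterior H l m \<delta> H' (p \<circ> ?\<tau>)"
      using best_posterior_transfer[OF less.prems feas] diff lij by simp
    have "supp (p \<circ> ?\<tau>) - {1..H'} \<subset> supp p - {1..H'}"
    proof (intro psubsetI subsetI)
      fix k assume k: "k \<in> supp (p \<circ> ?\<tau>) - {1..H'}"
      then have "k \<noteq> i" using pij by (auto simp: supp_def)
      moreover have "k \<noteq> j" using k j by blast
      ultimately show "k \<in> supp p - {1..H'}" using k by (simp add: supp_def)
    next
      have "i \<notin> supp (p \<circ> ?\<tau>)" using pij by (simp add: supp_def)
      then show "supp (p \<circ> ?\<tau>) - {1..H'} \<noteq> supp p - {1..H'}" using i by blast
    qed
    then have "card (supp (p \<circ> ?\<tau>) - {1..H'}) < card (supp p - {1..H'})"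
      using fin by (intro psubset_card_mono) auto
    from less.hyps[OF this best\<tau>] obtain \<sigma> where
      \<sigma>: "\<sigma> permutes {1..H}" "\<forall>k\<in>{1..H}. l (\<sigma> k) = l k"
        "best_posterior H l m \<delta> H' (p \<circ> ?\<tau> \<circ> \<sigma>)" "supp (p \<circ> ?\<tau> \<circ> \<sigma>) = {1..H'}"
      by blast
    have "l (?\<tau> (\<sigma> k)) = l k" if "k \<in> {1..H}" for k
      using \<sigma>(2) that lij by (metis transpose_def)
    then show ?thesis
      using \<sigma> permutes_compose[OF \<sigma>(1) \<tau>]
      by (intro exI[of _ "?\<tau> \<circ> \<sigma>"]) (simp add: o_assoc)
  qed
qed

section \<open>Stationarity on the support\<close>

lemma supp_perturb_eventually:
  fixes q d :: "nat \<Rightarrow> real"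
  assumes q: "q \<in> posteriors H" and d: "\<And>i. q i = 0 \<Longrightarrow> d i = 0"
    and "(\<Sum>i=1..H. d i) = 0"
  shows "\<forall>\<^sub>F t in nhds 0. (\<lambda>i. q i + t * d i) \<in> posteriors H \<and> supp (\<lambda>i. q i + t * d i) = supp q"
proof -
  have fin: "finite (supp q)" using supp_subset[OF q] finite_subset by blast
  have "\<forall>\<^sub>F t in nhds 0. \<forall>i\<in>supp q. 0 < q i + t * d i"
  proof (intro eventually_ball_finite[OF fin] ballI)
    fix i assume "i \<in> supp q"
    then have "0 < q i" by (simp add: supp_def)
    moreover have "((\<lambda>t. q i + t * d i) \<longlongrightarrow> q i + 0 * d i) (nhds 0)"
      by (intro tendsto_intros filterlim_ident)
    ultimately show "\<forall>\<^sub>F t in nhds 0. 0 < q i + t * d i"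
      by (intro order_tendstoD(1)[where y = "q i + 0 * d i"]) simp_all
  qed
  then show ?thesis
  proof (eventually_elim)
    case (elim t)
    have off: "q i = 0 \<and> d i = 0" if "i \<notin> supp q" for i
    proof -
      have "q i = 0" using that q by (simp add: supp_def posteriors_def not_less order_antisym)
      then show ?thesis using d by simp
    qed
    have nn: "0 \<le> q i + t * d i" for i
    proof (cases "i \<in> supp q")
      case True
      then show ?thesis using elim by (simp add: less_imp_le)
    qed (use off in simp)
    have "supp (\<lambda>i. q i + t * d i) = supp q"
    proof (intro set_eqI)
      show "i \<in> supp (\<lambda>i. q i + t * d i) \<longleftrightarrow> i \<in> supp q" for i
      proof (cases "i \<in> supp q")
        case True
        then show ?thesis using elim by (simp add: supp_def)
      next
        case False
        then show ?thesis using off[OF False] by (simp add: supp_def)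
      qed
    qed
    moreover have "(\<Sum>i=1..H. q i + t * d i) = 1"
      using q assms(3) by (simp add: posteriors_def sum.distrib sum_distrib_left[symmetric])
    moreover have "q i + t * d i = 0" if "i \<notin> {1..H}" for i
    proof -
      have "i \<notin> supp q" using supp_subset[OF q] that by blast
      then show ?thesis using off by simp
    qed
    ultimately show ?case using nn by (simp add: posteriors_def)
  qed
qed

text \<open>
  Perturbations within the support remain competitors for small parameters of either sign, so the
  bound has an interior local minimum along the line. The condition \<open>b + c s / (2 r\<^sup>3) = 0\<close>, with
  \<open>b\<close>, \<open>s\<close> the inner products of \<open>d\<close> with \<open>l\<close>, \<open>q\<close>, is stated free of denominators.
\<close>

lemma best_posterior_stationary:
  assumes best: "best_posterior H l m \<delta> H' q"
    and d: "\<And>i. q i = 0 \<Longrightarrow> d i = 0" and d0: "(\<Sum>i=1..H. d i) = 0"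
  shows "concentration_coeff H m \<delta> * (\<Sum>i=1..H. q i * d i)
           + 2 * (\<Sum>i=1..H. l i * d i) * root 4 (\<Sum>i=1..H. (q i)\<^sup>2) ^ 3 = 0"
proof -
  note q = best_posteriorD[OF best]
  let ?c = "concentration_coeff H m \<delta>"
  define S where "S = (\<Sum>i=1..H. (q i)\<^sup>2)"
  define s where "s = (\<Sum>i=1..H. q i * d i)"
  define s2 where "s2 = (\<Sum>i=1..H. (d i)\<^sup>2)"
  define b where "b = (\<Sum>i=1..H. l i * d i)"
  define a where "a = (\<Sum>i=1..H. l i * q i)"
  define F where "F t = a + t * b + ?c * root 4 (S + 2 * t * s + t\<^sup>2 * s2)" for t
  have S: "0 < S" unfolding S_def by (rule posterior_sum_squares_pos[OF q(1)])
  have F: "B_sq_chi2 H l m \<delta> (\<lambda>i. q i + t * d i) = F t" for t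
    unfolding B_sq_chi2_eq F_def S_def s_def s2_def a_def b_def
    by (simp add: power2_sum power_mult_distrib sum.distrib sum_distrib_left algebra_simps)
  have "\<forall>\<^sub>F t in nhds 0. (\<lambda>i. q i + t * d i) \<in> posteriors H \<and> supp (\<lambda>i. q i + t * d i) = supp q"
    using d by (intro supp_perturb_eventually[OF q(1) _ d0])
  then have "\<forall>\<^sub>F t in nhds 0. F 0 \<le> F t"
  proof eventually_elim
    case (elim t)
    then show ?case using q(3)[of "\<lambda>i. q i + t * d i"] q(2) F[of t] F[of 0] by simp
  qed
  then obtain e where e: "e > 0" "\<And>t. dist t 0 < e \<Longrightarrow> F 0 \<le> F t"
    by (auto simp: eventually_nhds_metric)
  have "((\<lambda>t. a + t * b + ?c * root 4 (S + 2 * t * s + t\<^sup>2 * s2)) has_real_derivative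
          b + ?c * (inverse (real 4 * root 4 S ^ (4 - Suc 0)) * (2 * s))) (at 0)"
    using S by (auto intro!: derivative_eq_intros)
  then have "b + ?c * (inverse (real 4 * root 4 S ^ (4 - Suc 0)) * (2 * s)) = 0"
    using e unfolding F_def[symmetric]
    by (intro DERIV_local_min[where f = F and x = 0 and d = e]) (auto simp: dist_real_def)
  moreover have "root 4 S > 0" using S by simp
  ultimately have "?c * s + 2 * b * root 4 S ^ 3 = 0"
    by (simp add: field_simps)
  then show ?thesis unfolding S_def s_def b_def .
qed

lemma best_posterior_fixed_point:
  assumes best: "best_posterior H l m \<delta> H' q" and T: "supp q = {1..H'}"
    and "m \<ge> 1" "0 < \<delta>" "1 \<le> H'" "H' \<le> H"
  shows "fixed_point_eq H l m \<delta> H' q"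
proof -
  note q = best_posteriorD[OF best]
  let ?c = "concentration_coeff H m \<delta>"
  have c: "?c > 0" using assms by (intro concentration_coeff_pos) auto
  have off: "q i = 0" if "i \<notin> {1..H'}" for i
    using that T q(1) by (force simp: supp_def posteriors_def not_less intro: antisym)
  have pos: "q i > 0" if "i \<in> {1..H'}" for i
    using that T by (auto simp: supp_def)
  have restrict: "(\<Sum>i=1..H. f (q i)) = (\<Sum>i=1..H'. f (q i))" if "f 0 = 0" for f :: "real \<Rightarrow> real"
    using that off \<open>H' \<le> H\<close> by (intro sum.mono_neutral_right) auto
  define r3 where "r3 = root 4 (\<Sum>i=1..H. (q i)\<^sup>2) ^ 3"
  have r3: "r3 = (\<Sum>i=1..H'. (q i)\<^sup>2) powr (3/4)"
    unfolding r3_def restrict[of power2, OF zero_power2] by (intro root_4_cubed sum_nonneg) simp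
  have sum1: "(\<Sum>i=1..H'. q i) = 1"
    using q(1) restrict[of "\<lambda>x. x"] by (simp add: posteriors_def)
  have pair: "?c * (q i - q j) = 2 * r3 * (l j - l i)"
    if ij: "i \<in> {1..H'}" "j \<in> {1..H'}" for i j
  proof -
    let ?d = "\<lambda>k. (if k = i then 1 else 0) - (if k = j then 1 else 0) :: real"
    have inner: "(\<Sum>k=1..H. f k * ?d k) = f i - f j" for f :: "nat \<Rightarrow> real"
      using ij \<open>H' \<le> H\<close>
      by (simp add: right_diff_distrib sum_subtractf if_distrib[of "(*) _"] cong: if_cong)
    have "?c * (\<Sum>k=1..H. q k * ?d k) + 2 * (\<Sum>k=1..H. l k * ?d k) * r3 = 0"
      unfolding r3_def
    proof (rule best_posterior_stationary[OF best])
      show "?d k = 0" if "q k = 0" for k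
        using that pos[OF ij(1)] pos[OF ij(2)] by auto
      show "(\<Sum>k=1..H. ?d k) = 0" using inner[of "\<lambda>_. 1"] by simp
    qed
    then show ?thesis unfolding inner by (simp add: algebra_simps)
  qed
  have "q i = 1 / real H' + 2 * r3 / ?c * ((\<Sum>k=1..H'. l k) / real H' - l i)"
    if i: "i \<in> {1..H'}" for i
  proof -
    have "(\<Sum>j=1..H'. ?c * (q i - q j)) = (\<Sum>j=1..H'. 2 * r3 * (l j - l i))"
      using pair[OF i] by (intro sum.cong) auto
    then have "?c * (real H' * q i - 1) = 2 * r3 * ((\<Sum>k=1..H'. l k) - real H' * l i)"
      using sum1 by (simp add: sum_distrib_left[symmetric] sum_subtractf)
    then show ?thesis using c \<open>1 \<le> H'\<close> by (simp add: field_simps)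
  qed
  then show ?thesis
    unfolding fixed_point_eq_def r3 concentration_coeff_def using off by auto
qed

section \<open>Uniqueness on a given support\<close>

text \<open>
  Both minimizers are stationary along \<open>d = p - q\<close>. Their bounds agree, so \<open>\<Sum>l\<^sub>id\<^sub>i = c (x - y)\<close>;
  inserting this into the two stationarity conditions gives \<open>\<Sum>q\<^sub>id\<^sub>i = -2 (x - y) x\<^sup>3\<close> and
  \<open>\<Sum>p\<^sub>id\<^sub>i = -2 (x - y) y\<^sup>3\<close>. Their sum is \<open>y\<^sup>4 - x\<^sup>4\<close>, which leaves \<open>(x - y)\<^sup>3 (x + y) = 0\<close>; with
  \<open>x = y\<close> both inner products vanish, and their difference is \<open>\<Sum>d\<^sub>i\<^sup>2\<close>.
\<close>

lemma best_posterior_unique_on_support: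
  assumes bq: "best_posterior H l m \<delta> H' q" and bp: "best_posterior H l m \<delta> H' p"
    and eq: "supp p = supp q" and "m \<ge> 1" "0 < \<delta>" "1 \<le> H"
  shows "p = q"
proof -
  note q = best_posteriorD[OF bq] and p = best_posteriorD[OF bp]
  let ?c = "concentration_coeff H m \<delta>"
  have c: "?c > 0" using assms by (intro concentration_coeff_pos) auto
  define d where "d i = p i - q i" for i
  define x where "x = root 4 (\<Sum>i=1..H. (q i)\<^sup>2)"
  define y where "y = root 4 (\<Sum>i=1..H. (p i)\<^sup>2)"
  have xy: "x > 0" "y > 0" unfolding x_def y_def
    using posterior_sum_squares_pos[OF q(1)] posterior_sum_squares_pos[OF p(1)] by simp_all
  have zero_iff: "p i = 0 \<longleftrightarrow> q i = 0" for i
  proof -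
    have "0 \<le> p i" "0 \<le> q i" using p(1) q(1) by (auto simp: posteriors_def)
    moreover have "p i > 0 \<longleftrightarrow> q i > 0" using eq by (auto simp: supp_def)
    ultimately show ?thesis by auto
  qed
  have d0: "(\<Sum>i=1..H. d i) = 0"
    using p(1) q(1) by (simp add: d_def sum_subtractf posteriors_def)
  define b where "b = (\<Sum>i=1..H. l i * d i)"
  define sq where "sq = (\<Sum>i=1..H. q i * d i)"
  define sp where "sp = (\<Sum>i=1..H. p i * d i)"
  have "?c * sq + 2 * b * x ^ 3 = 0"
    unfolding sq_def b_def x_def
    by (rule best_posterior_stationary[OF bq _ d0]) (simp add: d_def zero_iff)
  moreover have "?c * sp + 2 * b * y ^ 3 = 0"
    unfolding sp_def b_def y_def
    by (rule best_posterior_stationary[OF bp _ d0]) (simp add: d_def flip: zero_iff)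
  moreover have b: "b = ?c * (x - y)"
  proof -
    have "B_sq_chi2 H l m \<delta> p = B_sq_chi2 H l m \<delta> q"
      using q(3)[OF p(1,2)] p(3)[OF q(1,2)] by simp
    then show ?thesis
      by (simp add: B_sq_chi2_eq b_def d_def x_def y_def right_diff_distrib sum_subtractf)
  qed
  ultimately have "?c * (sq + 2 * (x - y) * x ^ 3) = 0" and "?c * (sp + 2 * (x - y) * y ^ 3) = 0"
    by (simp_all add: algebra_simps)
  moreover have "z = 0" if "?c * z = 0" for z using that c by simp
  ultimately have "sq + 2 * (x - y) * x ^ 3 = 0" and "sp + 2 * (x - y) * y ^ 3 = 0" by blast+
  then have sq: "sq = - 2 * (x - y) * x ^ 3" and sp: "sp = - 2 * (x - y) * y ^ 3"
    by (simp_all add: algebra_simps)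
  have "x ^ 4 = (\<Sum>i=1..H. (q i)\<^sup>2)" "y ^ 4 = (\<Sum>i=1..H. (p i)\<^sup>2)"
    unfolding x_def y_def by (auto intro!: real_root_pow_pos2 sum_nonneg)
  then have "sq + sp = y ^ 4 - x ^ 4"
    unfolding sq_def sp_def d_def
    by (simp add: sum_subtractf[symmetric] sum.distrib[symmetric] power2_eq_square algebra_simps)
  then have "(x - y) ^ 3 * (x + y) = 0"
    unfolding sq sp by (simp add: algebra_simps power2_eq_square power3_eq_cube power4_eq_xxxx)
  then have "x = y" using xy by simp
  then have "sp - sq = 0" using sp sq by simp
  then have "(\<Sum>i=1..H. (d i)\<^sup>2) = 0"
    unfolding sp_def sq_def d_def
    by (simp add: sum_subtractf[symmetric] power2_eq_square algebra_simps)
  then have "\<forall>i\<in>{1..H}. d i = 0" by (simp add: sum_nonneg_eq_0_iff)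
  moreover have "d i = 0" if "i \<notin> {1..H}" for i
    using that p(1) q(1) by (simp add: d_def posteriors_def)
  ultimately show "p = q" by (fastforce simp: d_def)
qed

section \<open>The best posterior\<close>

theorem theorem8:
  fixes H H' m :: nat and l :: "nat \<Rightarrow> real" and \<delta> :: real
  assumes risks: "\<forall>i\<in>{1..H}. 0 \<le> l i \<and> l i \<le> 1"
    and sorted: "mono_on {1..H} l"
    and "m \<ge> 1" and "0 < \<delta>" and "\<delta> < 1"
    and "1 \<le> H'" and "H' \<le> H"
    and attained: "\<exists>q. best_posterior H l m \<delta> H' q"
  shows "\<exists>q. best_posterior H l m \<delta> H' q \<and>
             supp q = {1..H'} \<and>
             fixed_point_eq H l m \<delta> H' q \<and> (\<forall>i\<in>{1..H'}. q i > 0) \<and>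
             (\<forall>p. best_posterior H l m \<delta> H' p \<longrightarrow>
                (\<exists>\<sigma>. \<sigma> permutes {1..H} \<and> (\<forall>i\<in>{1..H}. l (\<sigma> i) = l i) \<and> p = q \<circ> \<sigma>))"
proof -
  note move = best_posterior_permute_support[OF _ sorted \<open>H' \<le> H\<close>]
  obtain q where q: "best_posterior H l m \<delta> H' q" "supp q = {1..H'}"
    using attained move by metis
  have "\<exists>\<sigma>. \<sigma> permutes {1..H} \<and> (\<forall>i\<in>{1..H}. l (\<sigma> i) = l i) \<and> p = q \<circ> \<sigma>"
    if p: "best_posterior H l m \<delta> H' p" for p
  proof -
    obtain \<sigma> where \<sigma>: "\<sigma> permutes {1..H}" "\<forall>i\<in>{1..H}. l (\<sigma> i) = l i"
      and p\<sigma>: "best_posterior H l m \<delta> H' (p \<circ> \<sigma>)" "supp (p \<circ> \<sigma>) = {1..H'}"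
      using move[OF p] by blast
    have eq: "p \<circ> \<sigma> = q"
      using assms q p\<sigma> by (intro best_posterior_unique_on_support[OF q(1) p\<sigma>(1)]) auto
    have inv: "inv \<sigma> permutes {1..H}" by (rule permutes_inv[OF \<sigma>(1)])
    have "l (inv \<sigma> i) = l i" if "i \<in> {1..H}" for i
      using \<sigma>(2) permutes_in_image[OF inv] permutes_inverses(1)[OF \<sigma>(1)] that by metis
    moreover have "p = q \<circ> inv \<sigma>"
      using permutes_inverses(1)[OF \<sigma>(1)] by (auto simp flip: eq)
    ultimately show ?thesis using inv by blast
  qed
  moreover have "fixed_point_eq H l m \<delta> H' q"
    using assms q by (intro best_posterior_fixed_point) auto
  moreover have "\<forall>i\<in>{1..H'}. q i > 0" using q(2) by (auto simp: supp_def)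
  ultimately show ?thesis using q by blast
qed

end
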